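(* Let $C$ be a convex body in $\mathbb{R}^d$, $d\geq 2$, and let $n\geq 2$. Then there exists a balanced optimal $n$-division of $C$ for the Max-min problem for the width. Moreover, any optimal $2$-division of $C$ for the Max-min problem for the width is balanced.
   Context: A convex body in $\mathbb{R}^d$ is a compact convex set with non-empty interior. An $n$-division $P$ of $C$ is a decomposition of $C$ into $n$ closed subsets $C_1,\ldots,C_n$ with non-empty interior, obtained by $n-1$ successive hyperplane cuts: starting from $C$ itself, at each step exactly one of the current subsets is divided into two subsets by a hyperplane (the other current subsets are not cut). The (minimal) width $w$ of a compact set is the smallest distance between two parallel supporting hyperplanes of the set. For an $n$-division $P$ of $C$ with subsets $C_1,\ldots,C_n$, put $\widetilde w(P)=\min\{w(C_1),\ldots,w(C_n)\}$ and $\widetilde w_n(C)=\sup\{\widetilde w(P): P\text{ is an }n\text{-division of }C\}$. An $n$-division $P$ is optimal for the Max-min problem for the width if $\widetilde w(P)=\widetilde w_n(C)$, and balanced if $w(C_1)=\ldots=w(C_n)$. *)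

theory Defs
  imports "HOL-Analysis.Analysis"
begin

definition convex_body :: "'a::euclidean_space set \<Rightarrow> bool" where
  "convex_body C \<longleftrightarrow> compact C \<and> convex C \<and> interior C \<noteq> {}"

(* The two hyperplanes support S from opposite sides.  They coincide only if S lies
   in a single hyperplane; without this, the pair (H, H) would always have distance 0. *)
definition parallel_supporting_hyperplanes ::
    "'a::euclidean_space set \<Rightarrow> 'a set \<Rightarrow> 'a set \<Rightarrow> bool" where
  "parallel_supporting_hyperplanes S H H' \<longleftrightarrow>
     (\<exists>a b b'. a \<noteq> 0 \<and> H = {x. a \<bullet> x = b} \<and> H' = {x. a \<bullet> x = b'} \<and>
        S \<subseteq> {x. b \<le> a \<bullet> x \<and> a \<bullet> x \<le> b'} \<and> S \<inter> H \<noteq> {} \<and> S \<inter> H' \<noteq> {})"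

definition width :: "'a::euclidean_space set \<Rightarrow> real" where
  "width S = Inf {setdist H H' | H H'. parallel_supporting_hyperplanes S H H'}"

(* A division is represented by the set of its pieces.  No piece is lost by using a set,
   since the pieces have non-empty and pairwise disjoint interiors.  Requiring non-empty
   interior at every cut is the same as requiring it of the final pieces, because every
   intermediate piece contains a final one and each piece without interior leaves
   descendants without interior. *)
inductive n_division :: "'a::euclidean_space set \<Rightarrow> nat \<Rightarrow> 'a set set \<Rightarrow> bool"
  for C :: "'a set" where
  start: "n_division C 1 {C}"
| cut: "\<lbrakk>n_division C n P; S \<in> P; a \<noteq> 0;
         S1 = S \<inter> {x. a \<bullet> x \<le> b}; S2 = S \<inter> {x. a \<bullet> x \<ge> b};
         interior S1 \<noteq> {}; interior S2 \<noteq> {}\<rbrakk>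
        \<Longrightarrow> n_division C (Suc n) ((P - {S}) \<union> {S1, S2})"

definition division_width :: "'a::euclidean_space set set \<Rightarrow> real" where
  "division_width P = Min (width ` P)"

definition maxmin_width :: "nat \<Rightarrow> 'a::euclidean_space set \<Rightarrow> real" where
  "maxmin_width n C = Sup {division_width P | P. n_division C n P}"

definition optimal_division :: "'a::euclidean_space set \<Rightarrow> nat \<Rightarrow> 'a set set \<Rightarrow> bool" where
  "optimal_division C n P \<longleftrightarrow> n_division C n P \<and> division_width P = maxmin_width n C"

definition balanced :: "'a::euclidean_space set set \<Rightarrow> bool" where
  "balanced P \<longleftrightarrow> (\<forall>S\<in>P. \<forall>T\<in>P. width S = width T)"

end

theory Submission imports Defs begin

text \<open>
  Write \<open>M n C\<close> for the optimal value \<open>maxmin_width n C\<close>.  An \<open>n\<close>-division with \<open>n \<ge> 2\<close> is a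
  first cut of \<open>C\<close> followed by a \<open>k\<close>-division of one half and an \<open>m\<close>-division of the other, where
  \<open>k + m = n\<close>.  Hence \<open>M n C\<close> is the supremum of \<open>min (M k L) (M m R)\<close> over all such \<open>k\<close>, \<open>m\<close>
  and all cuts of \<open>C\<close> into halves \<open>L\<close> and \<open>R\<close>, and a division into balanced optimal divisions of
  \<open>L\<close> and \<open>R\<close> is balanced as soon as \<open>M k L = M m R\<close>.  By induction on \<open>n\<close>, it suffices to find
  an optimal first cut with this property.

  All regularity of \<open>M\<close> comes from one inequality (\<open>maxmin_width_homothety\<close>): if a homothetic copy
  of \<open>C\<close> with ratio \<open>r\<close> lies in \<open>D\<close>, then \<open>r * M n C \<le> M n D\<close>, because cuts of the copy extend to
  cuts of \<open>D\<close>.  A half of a convex body, shrunk slightly towards a point of \<open>C\<close> strictly inside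
  the bounding half-space, fits into every half cut off by a nearby hyperplane.  This gives
  semicontinuity of \<open>M\<close> in the hyperplane, so that an optimal first cut exists by compactness
  (\<open>maxmin_width_optimal_first_cut\<close>), and continuity of \<open>M\<close> under translation of the hyperplane.
  Translating the hyperplane towards the better half increases the worse value, while the better
  one tends to \<open>0\<close> together with the thickness of its half.  By the intermediate value theorem
  the two values become equal at some position, where both are at least the old minimum
  (\<open>balancing_cut\<close>).

  For two pieces more is true: as the hyperplane is translated, the width of the growing half is
  a concave function of the position which ends at \<open>width C\<close>.  A half narrower than the other one
  is narrower than \<open>C\<close>, so it becomes strictly wider at once, and an unbalanced cut is not optimal
  (\<open>improve_unbalanced_cut\<close>).
\<close>

section \<open>Width\<close>

lemma setdist_parallel_hyperplanes:
  fixes a :: "'a::euclidean_space"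
  assumes "a \<noteq> 0"
  shows "setdist {x. a \<bullet> x = b} {x. a \<bullet> x = b'} = \<bar>b - b'\<bar> / norm a"
proof (rule antisym)
  let ?p = "\<lambda>c. (c / (a \<bullet> a)) *\<^sub>R a"
  have "setdist {x. a \<bullet> x = b} {x. a \<bullet> x = b'} \<le> dist (?p b) (?p b')"
    using assms by (intro setdist_le_dist) auto
  also have "dist (?p b) (?p b') = \<bar>b - b'\<bar> / norm a"
    using assms
    by (simp add: dist_norm flip: scaleR_left_diff_distrib diff_divide_distrib)
       (simp add: dot_square_norm power2_eq_square)
  finally show "setdist {x. a \<bullet> x = b} {x. a \<bullet> x = b'} \<le> \<bar>b - b'\<bar> / norm a" .
next
  have "\<bar>b - b'\<bar> / norm a \<le> dist x y" if "a \<bullet> x = b" "a \<bullet> y = b'" for x y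
  proof -
    have "\<bar>b - b'\<bar> = \<bar>a \<bullet> (x - y)\<bar>" using that by (simp add: inner_diff_right)
    also have "\<dots> \<le> norm a * dist x y" by (simp add: dist_norm Cauchy_Schwarz_ineq2)
    finally show ?thesis using assms by (simp add: divide_simps mult.commute)
  qed
  moreover have "(c / (a \<bullet> a)) *\<^sub>R a \<in> {x. a \<bullet> x = c}" for c using assms by simp
  ultimately show "\<bar>b - b'\<bar> / norm a \<le> setdist {x. a \<bullet> x = b} {x. a \<bullet> x = b'}"
    by (subst le_setdist_iff) blast
qed

text \<open>In a given direction the supporting hyperplanes are unique and their distance is the largest
  difference of heights of two points of the set.  A lower bound on the width is therefore a
  statement about pairs of points, from which the inequalities below follow pointwise.\<close>

lemma le_width_iff:
  fixes S :: "'a::euclidean_space set"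
  assumes "compact S" "S \<noteq> {}"
  shows "v \<le> width S \<longleftrightarrow> (\<forall>u. norm u = 1 \<longrightarrow> (\<exists>x\<in>S. \<exists>y\<in>S. v \<le> u \<bullet> x - u \<bullet> y))"
proof -
  let ?D = "{setdist H H' | H H'. parallel_supporting_hyperplanes S H H'}"
  have ex: "\<exists>x\<in>S. \<exists>y\<in>S. u \<bullet> x - u \<bullet> y \<in> ?D" if "norm u = 1" for u
  proof -
    have cont: "continuous_on S (\<lambda>x. u \<bullet> x)" by (intro continuous_intros)
    obtain x where x: "x \<in> S" "\<And>z. z \<in> S \<Longrightarrow> u \<bullet> z \<le> u \<bullet> x"
      using continuous_attains_sup[OF assms cont] by blast
    obtain y where y: "y \<in> S" "\<And>z. z \<in> S \<Longrightarrow> u \<bullet> y \<le> u \<bullet> z"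
      using continuous_attains_inf[OF assms cont] by blast
    let ?H = "\<lambda>c. {z. u \<bullet> z = c}"
    have "u \<noteq> 0" using that by auto
    moreover have "\<bar>u \<bullet> y - u \<bullet> x\<bar> = u \<bullet> x - u \<bullet> y" using x(2)[OF y(1)] by simp
    ultimately have "setdist (?H (u \<bullet> y)) (?H (u \<bullet> x)) = u \<bullet> x - u \<bullet> y"
      using that by (simp add: setdist_parallel_hyperplanes)
    moreover have "parallel_supporting_hyperplanes S (?H (u \<bullet> y)) (?H (u \<bullet> x))"
      unfolding parallel_supporting_hyperplanes_def
      using x y \<open>u \<noteq> 0\<close> by (intro exI[of _ u] exI[of _ "u \<bullet> y"] exI[of _ "u \<bullet> x"]) auto
    ultimately show ?thesis using x(1) y(1) by force
  qed
  have bdd: "bdd_below ?D" by (rule bdd_belowI[of _ 0]) (auto simp: setdist_pos_le)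
  show ?thesis
  proof (intro iffI allI impI)
    fix u :: 'a
    assume v: "v \<le> width S" and "norm u = 1"
    then obtain x y where "x \<in> S" "y \<in> S" "u \<bullet> x - u \<bullet> y \<in> ?D" using ex by blast
    moreover from this have "width S \<le> u \<bullet> x - u \<bullet> y"
      unfolding width_def using bdd by (intro cInf_lower)
    ultimately show "\<exists>x\<in>S. \<exists>y\<in>S. v \<le> u \<bullet> x - u \<bullet> y" using v by force
  next
    assume *: "\<forall>u. norm u = 1 \<longrightarrow> (\<exists>x\<in>S. \<exists>y\<in>S. v \<le> u \<bullet> x - u \<bullet> y)"
    obtain e :: 'a where "norm e = 1" using vector_choose_size[of 1] by auto
    then have "?D \<noteq> {}" using ex by blast
    moreover have "v \<le> d" if "d \<in> ?D" for d
    proof -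
      from that obtain a b b' where a: "a \<noteq> 0"
        and d: "d = setdist {x. a \<bullet> x = b} {x. a \<bullet> x = b'}"
        and S: "S \<subseteq> {x. b \<le> a \<bullet> x \<and> a \<bullet> x \<le> b'}"
        unfolding parallel_supporting_hyperplanes_def by blast
      obtain x y where xy: "x \<in> S" "y \<in> S" "v \<le> (a /\<^sub>R norm a) \<bullet> x - (a /\<^sub>R norm a) \<bullet> y"
        using *[rule_format, of "a /\<^sub>R norm a"] a by auto
      have "v \<le> (a \<bullet> x - a \<bullet> y) / norm a" using xy(3) by (simp add: diff_divide_distrib field_simps)
      also have "\<dots> \<le> \<bar>b - b'\<bar> / norm a"
      proof -
        have "b \<le> a \<bullet> y" "a \<bullet> x \<le> b'" using S xy(1,2) by auto
        then show ?thesis by (intro divide_right_mono) auto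
      qed
      finally show ?thesis using a d by (simp add: setdist_parallel_hyperplanes)
    qed
    ultimately show "v \<le> width S" unfolding width_def by (intro cInf_greatest)
  qed
qed

lemma width_le_extent:
  fixes S :: "'a::euclidean_space set"
  assumes "compact S" "S \<noteq> {}" "norm u = 1"
  shows "\<exists>x\<in>S. \<exists>y\<in>S. width S \<le> u \<bullet> x - u \<bullet> y"
  using le_width_iff[OF assms(1,2), of "width S"] assms(3) by simp

lemma width_nonneg:
  assumes "compact S" "S \<noteq> {}"
  shows "0 \<le> width S"
  unfolding le_width_iff[OF assms] using assms(2) by fastforce

text \<open>Minimal width is superadditive under Minkowski combinations, since in every direction the
  extents add up exactly.  With a singleton in place of one of the two sets this also
  yields monotonicity and the behaviour under homotheties.\<close>

lemma width_convex_combination: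
  fixes A B D :: "'a::euclidean_space set"
  assumes "compact A" "A \<noteq> {}" "compact B" "B \<noteq> {}" "compact D"
    and "0 \<le> r" "0 \<le> s"
    and sub: "\<And>x y. x \<in> A \<Longrightarrow> y \<in> B \<Longrightarrow> r *\<^sub>R x + s *\<^sub>R y \<in> D"
  shows "r * width A + s * width B \<le> width D"
proof -
  have "D \<noteq> {}" using assms by blast
  moreover have "\<exists>x\<in>D. \<exists>y\<in>D. r * width A + s * width B \<le> u \<bullet> x - u \<bullet> y" if u: "norm u = 1" for u
  proof -
    obtain x y where A: "x \<in> A" "y \<in> A" "width A \<le> u \<bullet> x - u \<bullet> y"
      using width_le_extent[OF assms(1,2) u] by blast
    obtain x' y' where B: "x' \<in> B" "y' \<in> B" "width B \<le> u \<bullet> x' - u \<bullet> y'"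
      using width_le_extent[OF assms(3,4) u] by blast
    have "r * width A + s * width B \<le> r * (u \<bullet> x - u \<bullet> y) + s * (u \<bullet> x' - u \<bullet> y')"
      using A B assms by (intro add_mono mult_left_mono)
    also have "\<dots> = u \<bullet> (r *\<^sub>R x + s *\<^sub>R x') - u \<bullet> (r *\<^sub>R y + s *\<^sub>R y')"
      by (simp add: algebra_simps)
    finally show ?thesis using sub A B by blast
  qed
  ultimately show ?thesis using le_width_iff[OF \<open>compact D\<close>] by blast
qed

lemma width_homothety_le:
  fixes S T :: "'a::euclidean_space set"
  assumes "compact S" "S \<noteq> {}" "compact T" "0 \<le> r"
    and "(\<lambda>x. c + r *\<^sub>R x) ` S \<subseteq> T"
  shows "r * width S \<le> width T"
proof -
  have "r * width S + 1 * width {c} \<le> width T"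
    by (rule width_convex_combination) (use assms in \<open>auto simp: add.commute\<close>)
  moreover have "0 \<le> width {c}" by (rule width_nonneg) auto
  ultimately show ?thesis by simp
qed

lemma convex_body_nonempty: "convex_body C \<Longrightarrow> C \<noteq> {}"
  unfolding convex_body_def using interior_subset by fastforce

lemma convex_body_extreme_point:
  fixes a :: "'a::euclidean_space"
  assumes "convex_body C"
  obtains q where "q \<in> C" "\<And>x. x \<in> C \<Longrightarrow> a \<bullet> x \<le> a \<bullet> q"
proof -
  have "continuous_on C (\<lambda>x. a \<bullet> x)" by (intro continuous_intros)
  moreover have "compact C" using assms by (simp add: convex_body_def)
  ultimately show thesis
    using continuous_attains_sup[of C "\<lambda>x. a \<bullet> x"] convex_body_nonempty[OF assms] that by blast
qed

lemma width_pos: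
  assumes "convex_body C"
  shows "0 < width C"
proof -
  from assms obtain x e where e: "e > 0" "cball x e \<subseteq> C"
    unfolding convex_body_def by (metis ex_in_conv mem_interior_cball)
  have "e \<le> width C"
    unfolding le_width_iff[OF conjunct1[OF assms[unfolded convex_body_def]] convex_body_nonempty[OF assms]]
  proof (intro allI impI)
    fix u :: 'a assume u: "norm u = 1"
    have "x + e *\<^sub>R u \<in> C" "x \<in> C" using e u by (auto simp: subset_iff dist_norm)
    moreover have "e \<le> u \<bullet> (x + e *\<^sub>R u) - u \<bullet> x"
      using u by (simp add: inner_add_right dot_square_norm)
    ultimately show "\<exists>x\<in>C. \<exists>y\<in>C. e \<le> u \<bullet> x - u \<bullet> y" by blast
  qed
  with e show ?thesis by simp
qed

section \<open>Halves of a convex body\<close>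

definition halfcut :: "'a::euclidean_space set \<Rightarrow> 'a \<Rightarrow> real \<Rightarrow> 'a set" where
  "halfcut C a b = C \<inter> {x. a \<bullet> x \<le> b}"

lemma mem_halfcut: "x \<in> halfcut C a b \<longleftrightarrow> x \<in> C \<and> a \<bullet> x \<le> b"
  by (auto simp: halfcut_def)

lemma convex_body_halfcut_iff:
  assumes "convex_body C"
  shows "convex_body (halfcut C a b) \<longleftrightarrow> interior (halfcut C a b) \<noteq> {}"
  using assms unfolding convex_body_def halfcut_def
  by (auto intro!: compact_Int_closed convex_Int simp: closed_halfspace_le convex_halfspace_le)

text \<open>A convex body is the closure of its interior, so an open half-space that contains a point of
  the body contains an interior point of it.\<close>

lemma convex_body_halfcut:
  assumes C: "convex_body C" and p: "p \<in> C" "a \<bullet> p < b"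
  shows "convex_body (halfcut C a b)"
proof -
  have "closure (interior C) = closure C"
    using C unfolding convex_body_def by (intro convex_closure_interior) auto
  then have "p \<in> closure (interior C)" using p closure_subset by blast
  moreover have op: "open {x. a \<bullet> x < b}" by (rule open_halfspace_lt)
  ultimately have "interior C \<inter> {x. a \<bullet> x < b} \<noteq> {}"
    using p(2) open_Int_closure_eq_empty[OF op, of "interior C"] by blast
  moreover have "interior C \<inter> {x. a \<bullet> x < b} \<subseteq> interior (halfcut C a b)"
    using interior_subset[of C] op
    by (intro interior_maximal) (auto simp: halfcut_def)
  ultimately show ?thesis using convex_body_halfcut_iff[OF C] by blast
qed

text \<open>The piece cut off by a hyperplane is no wider than its extent orthogonal to it.  So a lower
  bound on its width provides a point of the body at a definite distance from the hyperplane.\<close>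

lemma width_halfcut_point:
  assumes C: "convex_body (halfcut C a b)" and a: "norm a = 1"
  obtains p where "p \<in> C" "a \<bullet> p \<le> b - width (halfcut C a b)"
proof -
  let ?H = "halfcut C a b"
  have "\<exists>x\<in>?H. \<exists>y\<in>?H. width ?H \<le> a \<bullet> x - a \<bullet> y"
    using C a convex_body_nonempty[OF C] unfolding convex_body_def
    by (intro width_le_extent) auto
  then obtain x y where "x \<in> ?H" "y \<in> ?H" "width ?H \<le> a \<bullet> x - a \<bullet> y" by blast
  then show thesis using that[of y] by (auto simp: mem_halfcut)
qed

lemma interior_homothety_image_subset:
  fixes S T :: "'a::euclidean_space set"
  assumes "interior S \<noteq> {}" "0 < r" "(\<lambda>x. c + r *\<^sub>R x) ` S \<subseteq> T"
  shows "interior T \<noteq> {}"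
proof -
  from assms(1) obtain x e where e: "e > 0" "cball x e \<subseteq> S"
    by (metis ex_in_conv mem_interior_cball)
  have "(\<lambda>x. c + r *\<^sub>R x) ` cball x e = cball (c + r *\<^sub>R x) (r * e)"
    using cball_scale[of r x e] cball_translation[of c "r *\<^sub>R x" "r * e"] assms(2)
    by (metis (no_types, lifting) abs_of_pos image_cong image_image less_numeral_extra(3))
  then have "cball (c + r *\<^sub>R x) (r * e) \<subseteq> T" using assms(3) e(2) by (metis image_mono order_trans)
  then show ?thesis using assms(2) e(1) by (metis empty_iff mem_interior_cball mult_pos_pos)
qed

lemma halfcut_scale:
  assumes "0 < c"
  shows "halfcut C (c *\<^sub>R a) (c * b) = halfcut C a b"
  using assms by (auto simp: halfcut_def)

lemma interior_halfcuts_disjoint: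
  assumes "a \<noteq> 0"
  shows "interior (halfcut S a b) \<inter> interior (halfcut S (- a) (- b)) = {}"
proof -
  have "halfcut S a b \<inter> halfcut S (- a) (- b) \<subseteq> {x. a \<bullet> x = b}"
    by (auto simp: mem_halfcut)
  then have "interior (halfcut S a b \<inter> halfcut S (- a) (- b)) \<subseteq> interior {x. a \<bullet> x = b}"
    by (rule interior_mono)
  with assms show ?thesis by simp
qed

section \<open>Divisions as trees of cuts\<close>

lemma n_division_ge_1: "n_division C n P \<Longrightarrow> 1 \<le> n"
  by (induction rule: n_division.induct) auto

lemma n_division_finite: "n_division C n P \<Longrightarrow> finite P \<and> P \<noteq> {}"
  by (induction rule: n_division.induct) auto

lemma n_division_pieces:
  assumes "n_division C n P" "interior C \<noteq> {}" "S \<in> P"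
  shows "S \<subseteq> C \<and> interior S \<noteq> {}"
  using assms by (induction arbitrary: S rule: n_division.induct) auto

lemma n_division_disjoint:
  assumes "n_division C n P"
  shows "pairwise (\<lambda>S T. interior S \<inter> interior T = {}) P"
  using assms
proof (induction rule: n_division.induct)
  case start
  show ?case by simp
next
  case (cut n P S a S1 b S2)
  have "interior S1 \<inter> interior S2 = {}"
    using interior_halfcuts_disjoint[OF \<open>a \<noteq> 0\<close>, of S b] cut.hyps by (simp add: halfcut_def)
  moreover have "interior S1 \<subseteq> interior S" "interior S2 \<subseteq> interior S"
    using cut.hyps by (auto intro!: interior_mono)
  moreover have "interior T \<inter> interior S = {}" if "T \<in> P - {S}" for T
    using cut.IH cut.hyps(2) that unfolding pairwise_def by auto
  ultimately show ?case
    using cut.IH unfolding pairwise_def by (auto; blast)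
qed

lemma n_division_convex_body:
  assumes "n_division C n P" "convex_body C" "S \<in> P"
  shows "convex_body S"
  using assms
proof (induction arbitrary: S rule: n_division.induct)
  case start
  then show ?case by simp
next
  case (cut n P T a S1 b S2)
  then show ?case
    using convex_body_halfcut_iff[of T a b] convex_body_halfcut_iff[of T "-a" "-b"]
    by (auto simp: halfcut_def)
qed

lemma n_division_cut:
  assumes "n_division C n P" "S \<in> P" "a \<noteq> 0"
    and "interior (halfcut S a b) \<noteq> {}" "interior (halfcut S (- a) (- b)) \<noteq> {}"
  shows "n_division C (Suc n) ((P - {S}) \<union> {halfcut S a b, halfcut S (- a) (- b)})"
  using assms by (intro n_division.cut) (auto simp: halfcut_def)

text \<open>Since pieces have disjoint interiors, a set arising inside one piece never coincides with
  another piece; hence set operations on the collection of pieces agree with the operations on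
  the tree of cuts.\<close>

lemma n_division_refine:
  assumes P: "n_division C (Suc m) P" "D \<in> P" and C: "interior C \<noteq> {}"
    and Q: "n_division D k Q"
  shows "n_division C (m + k) ((P - {D}) \<union> Q)"
  using Q
proof (induction rule: n_division.induct)
  case start
  show ?case using P by (simp add: insert_absorb)
next
  case (cut k Q S a S1 b S2)
  have D: "interior D \<noteq> {}" using n_division_pieces[OF P(1) C P(2)] by blast
  have S: "S \<subseteq> D" "interior S \<noteq> {}" using n_division_pieces[OF cut.hyps(1) D cut.hyps(2)] by auto
  have "S \<notin> P - {D}"
  proof
    assume "S \<in> P - {D}"
    then have "interior S \<inter> interior D = {}"
      using n_division_disjoint[OF P(1)] P(2) unfolding pairwise_def by auto
    with S interior_mono[of S D] show False by blast
  qed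
  then have "(P - {D}) \<union> ((Q - {S}) \<union> {S1, S2}) = ((P - {D}) \<union> Q - {S}) \<union> {S1, S2}"
    by blast
  moreover have "n_division C (Suc (m + k)) (((P - {D}) \<union> Q - {S}) \<union> {S1, S2})"
    by (rule n_division.cut[OF cut.IH _ cut.hyps(3-7)]) (use cut.hyps in auto)
  ultimately show ?case by simp
qed

lemma halfcut_disjoint_pieces:
  assumes "a \<noteq> 0" "interior (halfcut C a b) \<noteq> {}" "n_division (halfcut C a b) k P" "S \<in> P"
    and "T \<subseteq> halfcut C (- a) (- b)"
  shows "S \<noteq> T"
proof -
  have "interior S \<subseteq> interior (halfcut C a b)" "interior S \<noteq> {}"
    using n_division_pieces[OF assms(3,2,4)] interior_mono by auto
  with interior_halfcuts_disjoint[OF assms(1), of C b] interior_mono[OF assms(5)]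
  show ?thesis by blast
qed

lemma n_division_join:
  assumes C: "interior C \<noteq> {}" and a: "a \<noteq> 0"
    and H: "interior (halfcut C a b) \<noteq> {}" "interior (halfcut C (- a) (- b)) \<noteq> {}"
    and P: "n_division (halfcut C a b) k P" and Q: "n_division (halfcut C (- a) (- b)) m Q"
  shows "n_division C (k + m) (P \<union> Q)"
proof -
  let ?L = "halfcut C a b" and ?R = "halfcut C (- a) (- b)"
  have "?L \<noteq> ?R" using interior_halfcuts_disjoint[OF a, of C b] H by auto
  have "n_division C (Suc 1) {?L, ?R}"
    using n_division_cut[OF n_division.start _ a H] by simp
  from n_division_refine[OF this _ C P]
  have "n_division C (Suc k) (insert ?R P)"
    using \<open>?L \<noteq> ?R\<close> by (simp add: insert_Diff_if)
  from n_division_refine[OF this _ C Q]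
  have "n_division C (k + m) ((insert ?R P - {?R}) \<union> Q)" by simp
  moreover have "?R \<notin> P" using halfcut_disjoint_pieces[OF a H(1) P, of ?R ?R] by auto
  ultimately show ?thesis by simp
qed

text \<open>The inductive definition exposes the last cut of a division.  The recursion for the optimal
  value needs the first one: a later cut concerns a piece of exactly one of the two halves, again
  because pieces of different halves are different sets.\<close>

lemma n_division_first_cut_cases:
  assumes "n_division C n P"
  shows "(n = 1 \<and> P = {C}) \<or>
    (\<exists>a b k m P1 P2. a \<noteq> 0 \<and> n = k + m \<and>
      interior (halfcut C a b) \<noteq> {} \<and> interior (halfcut C (- a) (- b)) \<noteq> {} \<and>
      n_division (halfcut C a b) k P1 \<and> n_division (halfcut C (- a) (- b)) m P2 \<and>
      P = P1 \<union> P2)"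
  using assms
proof (induction rule: n_division.induct)
  case start
  show ?case by simp
next
  case (cut n P S a S1 b S2)
  from cut.IH show ?case
  proof (elim disjE conjE exE)
    assume "n = 1" "P = {C}"
    then have S: "S1 = halfcut C a b" "S2 = halfcut C (- a) (- b)" "(P - {S}) \<union> {S1, S2} = {S1} \<union> {S2}"
      using cut.hyps by (auto simp: halfcut_def)
    have "n_division (halfcut C a b) 1 {S1}" "n_division (halfcut C (- a) (- b)) 1 {S2}"
      using S(1,2) n_division.start by auto
    moreover have "Suc n = 1 + 1" using \<open>n = 1\<close> by simp
    ultimately show ?thesis using S cut.hyps(3,6,7) by metis
  next
    fix a' b' k m P1 P2
    assume *: "a' \<noteq> 0" "n = k + m" "interior (halfcut C a' b') \<noteq> {}"
      "interior (halfcut C (- a') (- b')) \<noteq> {}" "P = P1 \<union> P2"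
      and 1: "n_division (halfcut C a' b') k P1"
      and 2: "n_division (halfcut C (- a') (- b')) m P2"
    have disj: "P1 \<inter> P2 = {}"
    proof -
      have "S \<noteq> T" if "S \<in> P1" "T \<in> P2" for S T
        using halfcut_disjoint_pieces[OF *(1,3) 1 that(1)] n_division_pieces[OF 2 *(4) that(2)]
        by blast
      then show ?thesis by blast
    qed
    consider "S \<in> P1" | "S \<in> P2" using cut.hyps * by blast
    then show ?thesis
    proof cases
      assume S: "S \<in> P1"
      note n_division.cut[OF 1 S cut.hyps(3-7)]
      moreover have "(P - {S}) \<union> {S1, S2} = ((P1 - {S}) \<union> {S1, S2}) \<union> P2"
        using S disj * by blast
      moreover have "Suc n = Suc k + m" using * by simp
      ultimately show ?thesis using * 2 by blast
    next
      assume S: "S \<in> P2"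
      note n_division.cut[OF 2 S cut.hyps(3-7)]
      moreover have "(P - {S}) \<union> {S1, S2} = P1 \<union> ((P2 - {S}) \<union> {S1, S2})"
        using S disj * by blast
      moreover have "Suc n = k + Suc m" using * by simp
      ultimately show ?thesis using * 1 by blast
    qed
  qed
qed

lemma n_division_1:
  assumes "n_division C 1 P"
  shows "P = {C}"
proof -
  have "k + m \<noteq> 1" if "n_division A k Q" "n_division B m R" for A B :: "'a set" and k m Q R
    using n_division_ge_1[OF that(1)] n_division_ge_1[OF that(2)] by linarith
  then show ?thesis using n_division_first_cut_cases[OF assms] by metis
qed

text \<open>Normal vectors of length \<open>1\<close> keep the parameters of the first cut in a compact set.\<close>

lemma n_division_first_cutE:
  assumes "n_division C n P" "convex_body C" "2 \<le> n"
  obtains a b k m P1 P2 where "norm a = 1" "n = k + m" "1 \<le> k" "1 \<le> m"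
    "convex_body (halfcut C a b)" "convex_body (halfcut C (- a) (- b))"
    "n_division (halfcut C a b) k P1" "n_division (halfcut C (- a) (- b)) m P2" "P = P1 \<union> P2"
proof -
  obtain a b k m P1 P2 where *: "a \<noteq> 0" "n = k + m"
      "interior (halfcut C a b) \<noteq> {}" "interior (halfcut C (- a) (- b)) \<noteq> {}"
      "n_division (halfcut C a b) k P1" "n_division (halfcut C (- a) (- b)) m P2" "P = P1 \<union> P2"
    using n_division_first_cut_cases[OF assms(1)] assms(3)
    by (elim disjE exE conjE) (linarith, blast)
  define u where "u = a /\<^sub>R norm a"
  define c where "c = b / norm a"
  have "a = norm a *\<^sub>R u" "b = norm a * c" "norm u = 1" using * by (auto simp: u_def c_def)
  then have "halfcut C a b = halfcut C u c" "halfcut C (- a) (- b) = halfcut C (- u) (- c)"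
    using halfcut_scale[of "norm a" C u c] halfcut_scale[of "norm a" C "- u" "- c"] * by auto
  then show thesis
    using * that[of u k m c P1 P2] \<open>norm u = 1\<close> n_division_ge_1 convex_body_halfcut_iff[OF assms(2)]
    by metis
qed

lemma n_division_exists:
  assumes C: "convex_body C" and "1 \<le> n"
  shows "\<exists>P. n_division C n P"
  using \<open>1 \<le> n\<close>
proof (induction n rule: dec_induct)
  case base
  show ?case using n_division.start by blast
next
  case (step n)
  then obtain P where P: "n_division C n P" by blast
  then obtain S where S: "S \<in> P" using n_division_finite by blast
  have body: "convex_body S" using n_division_convex_body[OF P C S] .
  then obtain x e where x: "e > 0" "cball x e \<subseteq> S"
    unfolding convex_body_def by (metis ex_in_conv mem_interior_cball)
  obtain a :: 'a where a: "norm a = 1" using vector_choose_size[of 1] by auto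
  have "x - e *\<^sub>R a \<in> S" "x + e *\<^sub>R a \<in> S" using x a by (auto simp: subset_iff dist_norm)
  moreover have "a \<bullet> a = 1" using a by (simp add: dot_square_norm)
  ultimately have "convex_body (halfcut S a (a \<bullet> x))" "convex_body (halfcut S (- a) (- (a \<bullet> x)))"
    using x(1) convex_body_halfcut[OF body, of "x - e *\<^sub>R a" a]
      convex_body_halfcut[OF body, of "x + e *\<^sub>R a" "- a"]
    by (auto simp: inner_diff_right inner_add_right)
  moreover have "a \<noteq> 0" using a by auto
  ultimately show ?case
    using n_division_cut[OF P S, of a "a \<bullet> x"] unfolding convex_body_def by blast
qed

section \<open>The optimal value\<close>

lemma division_width_ge_iff:
  "n_division C n P \<Longrightarrow> v \<le> division_width P \<longleftrightarrow> (\<forall>S\<in>P. v \<le> width S)"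
  using n_division_finite[of C n P] by (simp add: division_width_def)

lemma division_width_Un:
  assumes "n_division A k P" "n_division B m Q"
  shows "division_width (P \<union> Q) = min (division_width P) (division_width Q)"
  using n_division_finite[OF assms(1)] n_division_finite[OF assms(2)]
  by (simp add: division_width_def image_Un Min_Un min_def)

lemma width_mono:
  assumes "convex_body C" "convex_body D" "C \<subseteq> D"
  shows "width C \<le> width D"
  using width_homothety_le[of C D 1 0] assms convex_body_nonempty[of C]
  by (simp add: convex_body_def)

lemma division_width_le_width:
  assumes "convex_body C" "n_division C n P"
  shows "division_width P \<le> width C"
proof -
  obtain S where S: "S \<in> P" using n_division_finite[OF assms(2)] by blast
  then have "division_width P \<le> width S" using division_width_ge_iff[OF assms(2)] by blast
  also have "\<dots> \<le> width C"
    using S assms n_division_convex_body n_division_pieces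
    by (metis convex_body_def width_mono)
  finally show ?thesis .
qed

lemma division_width_le_maxmin:
  assumes "convex_body C" "n_division C n P"
  shows "division_width P \<le> maxmin_width n C"
  unfolding maxmin_width_def
  using assms division_width_le_width[OF assms(1)]
  by (intro cSup_upper bdd_aboveI[of _ "width C"]) auto

lemma maxmin_width_leI:
  assumes "convex_body C" "1 \<le> n" "\<And>P. n_division C n P \<Longrightarrow> division_width P \<le> v"
  shows "maxmin_width n C \<le> v"
  unfolding maxmin_width_def
  using assms n_division_exists[OF assms(1,2)] by (intro cSup_least) auto

lemma maxmin_width_le_width:
  assumes "convex_body C" "1 \<le> n"
  shows "maxmin_width n C \<le> width C"
  using assms division_width_le_width by (intro maxmin_width_leI)

lemma maxmin_width_pos:
  assumes "convex_body C" "1 \<le> n"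
  shows "0 < maxmin_width n C"
proof -
  obtain P where P: "n_division C n P" using n_division_exists assms by blast
  have "0 < division_width P"
    unfolding division_width_def
    using n_division_finite[OF P] n_division_convex_body[OF P assms(1)] width_pos by auto
  with division_width_le_maxmin[OF assms(1) P] show ?thesis by simp
qed

lemma maxmin_width_1:
  assumes "convex_body C"
  shows "maxmin_width 1 C = width C"
proof (rule antisym)
  show "maxmin_width 1 C \<le> width C" using assms by (simp add: maxmin_width_le_width)
  show "width C \<le> maxmin_width 1 C"
    using division_width_le_maxmin[OF assms n_division.start] by (simp add: division_width_def)
qed

text \<open>The tree of cuts of \<open>C\<close> is carried by the homothety to its image, and the same hyperplanes cut
  the larger body \<open>D\<close> into pieces that contain the corresponding images.\<close>

lemma division_width_homothety:
  assumes "convex_body C" "convex_body D" "0 < r" "(\<lambda>x. c + r *\<^sub>R x) ` C \<subseteq> D"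
    and "n_division C n P"
  shows "\<exists>Q. n_division D n Q \<and> r * division_width P \<le> division_width Q"
  using assms
proof (induction n arbitrary: C D P rule: less_induct)
  case (less n)
  show ?case
  proof (cases "n = 1")
    case True
    then have "P = {C}" using less.prems n_division_1 by blast
    moreover have "r * width C \<le> width D"
      using less.prems convex_body_nonempty[of C]
      by (intro width_homothety_le[where c = c]) (auto simp: convex_body_def)
    ultimately show ?thesis
      using True n_division.start[of D] by (intro exI[of _ "{D}"]) (simp add: division_width_def)
  next
    case False
    then have "2 \<le> n" using n_division_ge_1[OF less.prems(5)] by linarith
    from n_division_first_cutE[OF less.prems(5,1) this]
    obtain a b k m P1 P2 where a: "norm a = 1" and n: "n = k + m" "1 \<le> k" "1 \<le> m"
      and body: "convex_body (halfcut C a b)" "convex_body (halfcut C (- a) (- b))"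
      and div: "n_division (halfcut C a b) k P1" "n_division (halfcut C (- a) (- b)) m P2"
      and P: "P = P1 \<union> P2" .
    define b' where "b' = a \<bullet> c + r * b"
    have sub: "(\<lambda>x. c + r *\<^sub>R x) ` halfcut C a b \<subseteq> halfcut D a b'"
      "(\<lambda>x. c + r *\<^sub>R x) ` halfcut C (- a) (- b) \<subseteq> halfcut D (- a) (- b')"
      using less.prems(3,4) by (auto simp: image_subset_iff mem_halfcut b'_def inner_add_right)
    then have int: "interior (halfcut D a b') \<noteq> {}" "interior (halfcut D (- a) (- b')) \<noteq> {}"
      using interior_homothety_image_subset less.prems(3) body unfolding convex_body_def by metis+
    then have body': "convex_body (halfcut D a b')" "convex_body (halfcut D (- a) (- b'))"
      using convex_body_halfcut_iff[OF less.prems(2)] by auto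
    obtain Q1 where Q1: "n_division (halfcut D a b') k Q1" "r * division_width P1 \<le> division_width Q1"
      using less.IH[OF _ body(1) body'(1) less.prems(3) sub(1) div(1)] n by auto
    obtain Q2 where Q2: "n_division (halfcut D (- a) (- b')) m Q2" "r * division_width P2 \<le> division_width Q2"
      using less.IH[OF _ body(2) body'(2) less.prems(3) sub(2) div(2)] n by auto
    have "a \<noteq> 0" using a by auto
    have "n_division D n (Q1 \<union> Q2)"
      unfolding n(1)
      by (rule n_division_join[OF _ \<open>a \<noteq> 0\<close> int Q1(1) Q2(1)])
         (use less.prems(2) in \<open>simp add: convex_body_def\<close>)
    moreover have "r * division_width P \<le> division_width (Q1 \<union> Q2)"
      unfolding P division_width_Un[OF div] division_width_Un[OF Q1(1) Q2(1)]
      using Q1(2) Q2(2) less.prems(3)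
      by (smt (verit, best) min_def mult_left_mono)
    ultimately show ?thesis by blast
  qed
qed

lemma maxmin_width_homothety:
  assumes "convex_body C" "convex_body D" "1 \<le> n" "0 < r" "(\<lambda>x. c + r *\<^sub>R x) ` C \<subseteq> D"
  shows "r * maxmin_width n C \<le> maxmin_width n D"
proof -
  have "maxmin_width n C \<le> maxmin_width n D / r"
  proof (rule maxmin_width_leI[OF assms(1,3)])
    fix P assume "n_division C n P"
    then obtain Q where "n_division D n Q" "r * division_width P \<le> division_width Q"
      using division_width_homothety[OF assms(1,2,4,5)] by blast
    with division_width_le_maxmin[OF assms(2)] assms(4)
    show "division_width P \<le> maxmin_width n D / r"
      by (fastforce simp: pos_le_divide_eq mult.commute)
  qed
  with assms(4) show ?thesis by (simp add: pos_le_divide_eq mult.commute)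
qed

lemma maxmin_width_mono:
  assumes "convex_body C" "convex_body D" "1 \<le> n" "C \<subseteq> D"
  shows "maxmin_width n C \<le> maxmin_width n D"
  using maxmin_width_homothety[of C D n 1 0] assms by simp

section \<open>Dependence on the cutting hyperplane\<close>

text \<open>The homotheties that compare different halves of the same body shrink towards a point of this
  body; by convexity only the linear constraint has to be checked.\<close>

lemma homothety_halfcut_subset:
  assumes "convex C" "p \<in> C" "0 \<le> r" "r \<le> 1"
    and H: "\<And>x. x \<in> C \<Longrightarrow> a' \<bullet> x \<le> b' \<Longrightarrow> (1 - r) * (a \<bullet> p) + r * (a \<bullet> x) \<le> b"
  shows "(\<lambda>x. (1 - r) *\<^sub>R p + r *\<^sub>R x) ` halfcut C a' b' \<subseteq> halfcut C a b"
proof (rule image_subsetI)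
  fix x assume x: "x \<in> halfcut C a' b'"
  have "(1 - r) *\<^sub>R p + r *\<^sub>R x \<in> C"
    using convexD[OF assms(1,2), of x "1 - r" r] x assms by (simp add: mem_halfcut)
  with H x show "(1 - r) *\<^sub>R p + r *\<^sub>R x \<in> halfcut C a b"
    by (simp add: mem_halfcut inner_add_right)
qed

text \<open>Upper semicontinuity of the optimal value of a half in its hyperplane.  Since the approximating
  halves have width bounded below, the limit half contains a point \<open>p\<close> at positive distance from
  its hyperplane.  Shrinking the approximating halves towards \<open>p\<close>, by a ratio that tends to \<open>1\<close>,
  moves them into the limit half.\<close>

lemma maxmin_width_halfcut_limit:
  assumes C: "convex_body C" and k: "1 \<le> k" and s: "0 < s"
    and approx: "\<And>\<delta>. 0 < \<delta> \<Longrightarrow> \<exists>a' b'. norm a' = 1 \<and> convex_body (halfcut C a' b') \<and>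
        s - \<delta> \<le> maxmin_width k (halfcut C a' b') \<and>
        (\<forall>x\<in>C. \<bar>(a' \<bullet> x - b') - (a \<bullet> x - b)\<bar> \<le> \<delta>)"
  shows "convex_body (halfcut C a b) \<and> s \<le> maxmin_width k (halfcut C a b)"
proof -
  \<comment> \<open>Within \<open>s / 4\<close>, the approximating half still has width at least \<open>3 * s / 4\<close>, and its deepest
    point keeps depth \<open>s / 2\<close> below the limit hyperplane.\<close>
  obtain a' b' where *: "norm a' = 1" "convex_body (halfcut C a' b')"
      "s - s / 4 \<le> maxmin_width k (halfcut C a' b')"
      "\<forall>x\<in>C. \<bar>(a' \<bullet> x - b') - (a \<bullet> x - b)\<bar> \<le> s / 4"
    using approx[of "s / 4"] s by auto
  obtain p where p: "p \<in> C" "a' \<bullet> p \<le> b' - width (halfcut C a' b')"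
    using width_halfcut_point[OF *(2,1)] .
  have "\<bar>(a' \<bullet> p - b') - (a \<bullet> p - b)\<bar> \<le> s / 4" using *(4) p(1) by blast
  then have "a \<bullet> p < b" using maxmin_width_le_width[OF *(2) k] *(3) p(2) s by linarith
  define g where "g = b - a \<bullet> p"
  have g: "0 < g" using \<open>a \<bullet> p < b\<close> by (simp add: g_def)
  have body: "convex_body (halfcut C a b)" by (rule convex_body_halfcut) fact+
  have bound: "(s - \<delta>) * (g / (g + \<delta>)) \<le> maxmin_width k (halfcut C a b)" if \<delta>: "0 < \<delta>" for \<delta>
  proof -
    \<comment> \<open>The ratio for which an overshoot \<open>\<delta>\<close> beyond the hyperplane is exactly compensated by the
      depth \<open>g\<close> of \<open>p\<close>.\<close>
    define r where "r = g / (g + \<delta>)"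
    have r: "0 < r" "r \<le> 1" "r * \<delta> = (1 - r) * g"
      using g \<delta> by (auto simp: r_def field_simps)
    obtain a' b' where *: "convex_body (halfcut C a' b')"
      "s - \<delta> \<le> maxmin_width k (halfcut C a' b')"
      "\<forall>x\<in>C. \<bar>(a' \<bullet> x - b') - (a \<bullet> x - b)\<bar> \<le> \<delta>"
      using approx[OF \<delta>] by blast
    have "(\<lambda>x. (1 - r) *\<^sub>R p + r *\<^sub>R x) ` halfcut C a' b' \<subseteq> halfcut C a b"
    proof (rule homothety_halfcut_subset)
      fix x assume x: "x \<in> C" "a' \<bullet> x \<le> b'"
      then have "a \<bullet> x \<le> b + \<delta>" using *(3) by force
      then have "r * (a \<bullet> x) \<le> r * (b + \<delta>)" using r by simp
      moreover have "a \<bullet> p = b - g" by (simp add: g_def)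
      then have "(1 - r) * (a \<bullet> p) = (1 - r) * b - r * \<delta>"
        using r(3) by (simp add: right_diff_distrib)
      ultimately show "(1 - r) * (a \<bullet> p) + r * (a \<bullet> x) \<le> b"
        by (simp add: algebra_simps)
    qed (use C p r in \<open>auto simp: convex_body_def\<close>)
    from maxmin_width_homothety[OF *(1) body k r(1) this]
    have "r * maxmin_width k (halfcut C a' b') \<le> maxmin_width k (halfcut C a b)" .
    moreover have "(s - \<delta>) * r \<le> r * maxmin_width k (halfcut C a' b')"
      using *(2) r(1) by (simp add: mult.commute)
    ultimately show ?thesis by (simp add: r_def)
  qed
  have "((\<lambda>\<delta>. (s - \<delta>) * (g / (g + \<delta>))) \<longlongrightarrow> (s - 0) * (g / (g + 0))) (at_right 0)"
    using g by (intro tendsto_intros) auto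
  moreover have "eventually (\<lambda>\<delta>. (s - \<delta>) * (g / (g + \<delta>)) \<le> maxmin_width k (halfcut C a b)) (at_right 0)"
    using bound by (auto simp: eventually_at_filter)
  ultimately have "(s - 0) * (g / (g + 0)) \<le> maxmin_width k (halfcut C a b)"
    by (rule tendsto_upperbound) simp
  with g body show ?thesis by simp
qed

text \<open>The first cuts of nearly optimal divisions are parametrized by a unit normal, an offset bounded
  by the radius of a ball around the origin that contains \<open>C\<close>, and the number of pieces in one
  half; a limit point of these parameters is an optimal first cut.\<close>

lemma maxmin_width_optimal_first_cut:
  assumes C: "convex_body C" and n: "2 \<le> n"
  obtains a b k m where "norm a = 1" "1 \<le> k" "1 \<le> m" "n = k + m"
    "convex_body (halfcut C a b)" "convex_body (halfcut C (- a) (- b))"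
    "maxmin_width n C \<le> maxmin_width k (halfcut C a b)"
    "maxmin_width n C \<le> maxmin_width m (halfcut C (- a) (- b))"
proof -
  define s where "s = maxmin_width n C"
  have s: "0 < s" unfolding s_def using n by (intro maxmin_width_pos C) simp
  obtain R where R: "R > 0" "\<And>x. x \<in> C \<Longrightarrow> norm x \<le> R"
    using compact_imp_bounded[of C] C by (auto simp: convex_body_def bounded_pos)
  define Z :: "('a \<times> real \<times> nat) set" where "Z = sphere 0 1 \<times> {- R..R} \<times> {1..<n}"
  define good where "good \<delta> = (\<lambda>(a, b, k). convex_body (halfcut C a b) \<and>
      convex_body (halfcut C (- a) (- b)) \<and> s - \<delta> \<le> maxmin_width k (halfcut C a b) \<and>
      s - \<delta> \<le> maxmin_width (n - k) (halfcut C (- a) (- b)))" for \<delta>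
  have "\<exists>z\<in>Z. good \<delta> z" if "0 < \<delta>" for \<delta>
  proof -
    have "\<not> maxmin_width n C \<le> s - \<delta>" using that by (simp add: s_def)
    then obtain P where P: "n_division C n P" "s - \<delta> \<le> division_width P"
      using maxmin_width_leI[OF C, of n "s - \<delta>"] n by fastforce
    from n_division_first_cutE[OF P(1) C n]
    obtain a b k m P1 P2 where a: "norm a = 1" and km: "n = k + m" "1 \<le> k" "1 \<le> m"
      and body: "convex_body (halfcut C a b)" "convex_body (halfcut C (- a) (- b))"
      and div: "n_division (halfcut C a b) k P1" "n_division (halfcut C (- a) (- b)) m P2"
      and Pe: "P = P1 \<union> P2" .
    have "s - \<delta> \<le> maxmin_width k (halfcut C a b)"
      "s - \<delta> \<le> maxmin_width m (halfcut C (- a) (- b))"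
      using P(2) division_width_le_maxmin[OF body(1) div(1)] division_width_le_maxmin[OF body(2) div(2)]
      unfolding Pe division_width_Un[OF div] by auto
    moreover have "- R \<le> b" "b \<le> R"
    proof -
      have *: "\<bar>a \<bullet> x\<bar> \<le> R" if "x \<in> C" for x
        using Cauchy_Schwarz_ineq2[of a x] a R(2)[OF that] by simp
      obtain x where "x \<in> halfcut C a b" using convex_body_nonempty[OF body(1)] by blast
      then show "- R \<le> b" using *[of x] by (auto simp: mem_halfcut)
      obtain y where "y \<in> halfcut C (- a) (- b)" using convex_body_nonempty[OF body(2)] by blast
      then show "b \<le> R" using *[of y] by (auto simp: mem_halfcut)
    qed
    ultimately show ?thesis
      using a km body by (intro bexI[of _ "(a, b, k)"]) (auto simp: good_def Z_def)
  qed
  then have "\<exists>z. \<forall>i. z i \<in> Z \<and> good (1 / Suc i) (z i)"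
    by (intro choice) (metis divide_pos_pos of_nat_0_less_iff zero_less_Suc zero_less_one)
  then obtain z where z: "\<And>i. z i \<in> Z" "\<And>i. good (1 / Suc i) (z i)" by blast
  have "compact Z" unfolding Z_def by (intro compact_Times) (auto intro: finite_imp_compact)
  then obtain l r where l: "l \<in> Z" "strict_mono (r :: nat \<Rightarrow> nat)" "(z \<circ> r) \<longlonglongrightarrow> l"
    using seq_compactE[OF compact_imp_seq_compact] z(1) by metis
  obtain a b k where lk: "l = (a, b, k)" by (cases l)
  have akl: "norm a = 1" "1 \<le> k" "1 \<le> n - k" "n = k + (n - k)" using l(1) by (auto simp: Z_def lk)
  define A where "A i = fst (z (r i))" for i
  define B where "B i = fst (snd (z (r i)))" for i
  define K where "K i = snd (snd (z (r i)))" for i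
  have "A \<longlonglongrightarrow> a" "B \<longlonglongrightarrow> b" "K \<longlonglongrightarrow> k"
    using tendsto_fst[OF l(3)] tendsto_fst[OF tendsto_snd[OF l(3)]]
      tendsto_snd[OF tendsto_snd[OF l(3)]]
    by (auto simp: A_def[abs_def] B_def[abs_def] K_def[abs_def] lk o_def)
  \<comment> \<open>The natural numbers are discrete, so the numbers of pieces are eventually constant.\<close>
  have evK: "eventually (\<lambda>i. K i = k) sequentially"
    using \<open>K \<longlonglongrightarrow> k\<close> by (simp add: nhds_discrete filterlim_principal)
  have close: "\<exists>a' b'. norm a' = 1 \<and> good \<delta> (a', b', k) \<and>
      (\<forall>x\<in>C. \<bar>(a' \<bullet> x - b') - (a \<bullet> x - b)\<bar> \<le> \<delta>)" if \<delta>: "0 < \<delta>" for \<delta>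
  proof -
    have "(\<lambda>i. norm (A i - a) * R + \<bar>B i - b\<bar>) \<longlonglongrightarrow> norm (a - a) * R + \<bar>b - b\<bar>"
      by (intro tendsto_intros \<open>A \<longlonglongrightarrow> a\<close> \<open>B \<longlonglongrightarrow> b\<close>)
    then have "eventually (\<lambda>i. norm (A i - a) * R + \<bar>B i - b\<bar> < \<delta>) sequentially"
      using \<delta> by (intro order_tendstoD(2)[where y = "norm (a - a) * R + \<bar>b - b\<bar>"]) auto
    moreover have "eventually (\<lambda>i. 1 / Suc i < \<delta>) sequentially"
      using LIMSEQ_inverse_real_of_nat order_tendstoD(2)[of _ 0 sequentially \<delta>] \<delta>
      by (simp add: inverse_eq_divide)
    ultimately have "eventually (\<lambda>i. norm (A i - a) * R + \<bar>B i - b\<bar> < \<delta> \<and> 1 / Suc i < \<delta> \<and> K i = k)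
        sequentially"
      using evK by eventually_elim auto
    then obtain i where i: "norm (A i - a) * R + \<bar>B i - b\<bar> < \<delta>" "1 / Suc i < \<delta>" "K i = k"
      using eventually_happens'[OF sequentially_bot] by blast
    have zi: "z (r i) = (A i, B i, k)" using i(3) by (simp add: A_def B_def K_def prod_eq_iff)
    have "1 / real (Suc (r i)) \<le> 1 / real (Suc i)"
      using seq_suble[OF l(2), of i] by (intro divide_left_mono) auto
    then have "good \<delta> (A i, B i, k)"
      using z(2)[of "r i"] i(2) unfolding zi good_def by auto
    moreover have "norm (A i) = 1" using z(1)[of "r i"] by (auto simp: zi Z_def)
    moreover have "\<bar>(A i \<bullet> x - B i) - (a \<bullet> x - b)\<bar> \<le> \<delta>" if "x \<in> C" for x
    proof -
      have "\<bar>(A i \<bullet> x - B i) - (a \<bullet> x - b)\<bar> \<le> \<bar>(A i - a) \<bullet> x\<bar> + \<bar>B i - b\<bar>"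
        by (simp add: inner_diff_left)
      also have "\<bar>(A i - a) \<bullet> x\<bar> \<le> norm (A i - a) * norm x" by (rule Cauchy_Schwarz_ineq2)
      also have "\<dots> \<le> norm (A i - a) * R" using R(2)[OF that] by (intro mult_left_mono) auto
      finally show ?thesis using i(1) by linarith
    qed
    ultimately show ?thesis by blast
  qed
  have "convex_body (halfcut C a b) \<and> s \<le> maxmin_width k (halfcut C a b)"
  proof (rule maxmin_width_halfcut_limit[OF C akl(2) s])
    fix \<delta> :: real assume "0 < \<delta>"
    from close[OF this] show "\<exists>a' b'. norm a' = 1 \<and> convex_body (halfcut C a' b') \<and>
        s - \<delta> \<le> maxmin_width k (halfcut C a' b') \<and>
        (\<forall>x\<in>C. \<bar>(a' \<bullet> x - b') - (a \<bullet> x - b)\<bar> \<le> \<delta>)"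
      unfolding good_def by blast
  qed
  moreover have "convex_body (halfcut C (- a) (- b)) \<and>
      s \<le> maxmin_width (n - k) (halfcut C (- a) (- b))"
  proof (rule maxmin_width_halfcut_limit[OF C akl(3) s])
    fix \<delta> :: real assume "0 < \<delta>"
    from close[OF this] obtain a' b' where *: "norm a' = 1" "good \<delta> (a', b', k)"
      "\<forall>x\<in>C. \<bar>(a' \<bullet> x - b') - (a \<bullet> x - b)\<bar> \<le> \<delta>" by blast
    have "\<bar>((- a') \<bullet> x - - b') - ((- a) \<bullet> x - - b)\<bar> \<le> \<delta>" if "x \<in> C" for x
      using *(3)[rule_format, OF that] by simp
    with * show "\<exists>a' b'. norm a' = 1 \<and> convex_body (halfcut C a' b') \<and>
        s - \<delta> \<le> maxmin_width (n - k) (halfcut C a' b') \<and>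
        (\<forall>x\<in>C. \<bar>(a' \<bullet> x - b') - ((- a) \<bullet> x - (- b))\<bar> \<le> \<delta>)"
      unfolding good_def by (intro exI[of _ "- a'"] exI[of _ "- b'"]) auto
  qed
  ultimately show thesis using that akl unfolding s_def by metis
qed

text \<open>Shrinking the half at position \<open>t\<close> towards \<open>p\<close> with ratio \<open>(s - a \<bullet> p) / (t - a \<bullet> p)\<close> moves it
  into the half at an earlier position \<open>s\<close>.  So the value, which is non-decreasing in the position,
  drops at most by this factor between \<open>t\<close> and \<open>s\<close>.  This is a Lipschitz bound away from
  \<open>a \<bullet> p\<close>.\<close>

lemma continuous_on_maxmin_width_halfcut:
  assumes C: "convex_body C" and k: "1 \<le> k" and p: "p \<in> C" "a \<bullet> p < t0"
  shows "continuous_on {t0..} (\<lambda>t. maxmin_width k (halfcut C a t))"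
proof -
  let ?F = "\<lambda>t. maxmin_width k (halfcut C a t)"
  define lo where "lo = a \<bullet> p"
  define L where "L = width C / (t0 - lo)"
  have lo: "lo < t0" using p by (simp add: lo_def)
  have L: "0 \<le> L" using width_pos[OF C] lo by (simp add: L_def)
  have body: "convex_body (halfcut C a t)" if "t0 \<le> t" for t
    using convex_body_halfcut[OF C p(1)] p(2) that by auto
  have *: "\<bar>?F t - ?F s\<bar> \<le> L * (t - s)" if st: "t0 \<le> s" "s \<le> t" for s t
  proof -
    have bs: "convex_body (halfcut C a s)" and bt: "convex_body (halfcut C a t)"
      using body st by auto
    have up: "?F s \<le> ?F t"
      by (rule maxmin_width_mono[OF bs bt k]) (use st in \<open>auto simp: halfcut_def\<close>)
    define r where "r = (s - lo) / (t - lo)"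
    have r: "0 < r" "r \<le> 1" "r * (t - lo) = s - lo"
      using st lo by (auto simp: r_def field_simps)
    have "(\<lambda>x. (1 - r) *\<^sub>R p + r *\<^sub>R x) ` halfcut C a t \<subseteq> halfcut C a s"
    proof (rule homothety_halfcut_subset)
      fix x assume "a \<bullet> x \<le> t"
      then have "r * (a \<bullet> x) \<le> r * t" using r by simp
      then show "(1 - r) * (a \<bullet> p) + r * (a \<bullet> x) \<le> s"
        using r(3) by (simp add: lo_def algebra_simps)
    qed (use C p r in \<open>auto simp: convex_body_def\<close>)
    from maxmin_width_homothety[OF bt bs k r(1) this] have "r * ?F t \<le> ?F s" .
    then have "?F t - ?F s \<le> (1 - r) * ?F t" by (simp add: algebra_simps)
    also have "1 - r = (t - s) / (t - lo)" using st lo by (simp add: r_def field_simps)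
    also have "(t - s) / (t - lo) * ?F t \<le> (t - s) / (t0 - lo) * width C"
    proof (rule mult_mono)
      show "(t - s) / (t - lo) \<le> (t - s) / (t0 - lo)"
        using st lo by (intro divide_left_mono) auto
      have "?F t \<le> width (halfcut C a t)" by (rule maxmin_width_le_width[OF bt k])
      also have "\<dots> \<le> width C" by (rule width_mono[OF bt C]) (auto simp: halfcut_def)
      finally show "?F t \<le> width C" .
    qed (use st lo maxmin_width_pos[OF bt k] in auto)
    finally show ?thesis using up by (simp add: L_def mult.commute)
  qed
  have "L-lipschitz_on {t0..} ?F"
  proof (rule lipschitz_onI[OF _ L])
    fix s t assume "s \<in> {t0..}" "t \<in> {t0..}"
    then show "dist (?F s) (?F t) \<le> L * dist s t"
      using *[of s t] *[of t s] by (cases "s \<le> t") (auto simp: dist_real_def abs_minus_commute)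
  qed
  then show ?thesis by (rule lipschitz_on_continuous_on)
qed

text \<open>The hyperplane is translated into the half with the larger value until both values agree.\<close>

lemma balancing_cut:
  assumes C: "convex_body C" and km: "1 \<le> k" "1 \<le> m" and a: "norm a = 1"
    and body: "convex_body (halfcut C a b)" "convex_body (halfcut C (- a) (- b))"
    and le: "maxmin_width k (halfcut C a b) \<le> maxmin_width m (halfcut C (- a) (- b))"
  shows "\<exists>t. convex_body (halfcut C a t) \<and> convex_body (halfcut C (- a) (- t)) \<and>
    maxmin_width k (halfcut C a t) = maxmin_width m (halfcut C (- a) (- t)) \<and>
    maxmin_width k (halfcut C a b) \<le> maxmin_width k (halfcut C a t)"
proof -
  let ?F = "\<lambda>t. maxmin_width k (halfcut C a t)"
  let ?G = "\<lambda>t. maxmin_width m (halfcut C (- a) (- t))"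
  obtain p where "p \<in> C" "a \<bullet> p \<le> b - width (halfcut C a b)"
    using width_halfcut_point[OF body(1) a] .
  then have p: "p \<in> C" "a \<bullet> p < b" using width_pos[OF body(1)] by auto
  have "norm (- a) = 1" using a by simp
  obtain q' where "q' \<in> C" "- a \<bullet> q' \<le> - b - width (halfcut C (- a) (- b))"
    using width_halfcut_point[OF body(2) \<open>norm (- a) = 1\<close>] .
  then have q': "q' \<in> C" "b < a \<bullet> q'" using width_pos[OF body(2)] by auto
  obtain q where q: "q \<in> C" "\<And>x. x \<in> C \<Longrightarrow> a \<bullet> x \<le> a \<bullet> q"
    using convex_body_extreme_point[OF C, of a] by blast
  have Fb: "0 < ?F b" using maxmin_width_pos[OF body(1) km(1)] .
  \<comment> \<open>At \<open>t1\<close> the remaining slab has thickness at most \<open>?F b\<close>, which bounds the value of the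
    second half; the maximum with \<open>b\<close> keeps \<open>t1\<close> on the correct side.\<close>
  define t1 where "t1 = max b (a \<bullet> q - ?F b)"
  have t1: "b \<le> t1" "t1 < a \<bullet> q" using Fb q(2)[OF q'(1)] q'(2) by (auto simp: t1_def)
  have body1: "convex_body (halfcut C a t)" if "b \<le> t" for t
    using convex_body_halfcut[OF C p(1)] p(2) that by auto
  have body2: "convex_body (halfcut C (- a) (- t))" if "t \<le> t1" for t
    using convex_body_halfcut[OF C q(1)] t1 that by auto
  have mono: "?F b \<le> ?F t" if "b \<le> t" for t
    by (rule maxmin_width_mono[OF body(1) body1[OF that] km(1)])
       (use that in \<open>auto simp: halfcut_def\<close>)
  have "?G t1 \<le> width (halfcut C (- a) (- t1))"
    by (rule maxmin_width_le_width[OF body2 km(2)]) simp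
  also obtain x where "x \<in> C" "- a \<bullet> x \<le> - t1 - width (halfcut C (- a) (- t1))"
    using width_halfcut_point[OF body2[OF order_refl] \<open>norm (- a) = 1\<close>] .
  then have "width (halfcut C (- a) (- t1)) \<le> a \<bullet> q - t1" using q(2) by force
  also have "\<dots> \<le> ?F b" by (simp add: t1_def)
  also have "\<dots> \<le> ?F t1" by (rule mono[OF t1(1)])
  finally have t1_le: "?G t1 \<le> ?F t1" .
  have contF: "continuous_on {b..t1} ?F"
    by (rule continuous_on_subset[OF continuous_on_maxmin_width_halfcut[OF C km(1) p]]) auto
  have "continuous_on {- t1..} (\<lambda>r. maxmin_width m (halfcut C (- a) r))"
    by (rule continuous_on_maxmin_width_halfcut[OF C km(2) q(1)]) (use t1 in auto)
  then have contG: "continuous_on {b..t1} ?G"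
    by (rule continuous_on_compose2) (auto intro!: continuous_intros)
  have "\<exists>t\<ge>b. t \<le> t1 \<and> ?F t - ?G t = 0"
    using le t1_le t1(1) by (intro IVT') (auto intro!: continuous_on_diff contF contG)
  then obtain t where "b \<le> t" "t \<le> t1" "?F t = ?G t" by auto
  then show ?thesis using body1 body2 mono by blast
qed

section \<open>Balanced optimal divisions\<close>

text \<open>The halves of a balanced optimal first cut have balanced optimal divisions of the same value by
  induction.  This value is at least \<open>maxmin_width n C\<close> by the choice of the cut, and at most that
  because the union is a division of \<open>C\<close>.\<close>

lemma balanced_optimal_division:
  assumes "convex_body C" "1 \<le> n"
  shows "\<exists>P. n_division C n P \<and> (\<forall>S\<in>P. width S = maxmin_width n C)"
  using assms
proof (induction n arbitrary: C rule: less_induct)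
  case (less n C)
  note C = less.prems(1)
  show ?case
  proof (cases "n = 1")
    case True
    then show ?thesis using n_division.start[of C] maxmin_width_1[OF C] by auto
  next
    case False
    then have "2 \<le> n" using less.prems by simp
    obtain a b k m where a: "norm a = 1" and km: "1 \<le> k" "1 \<le> m" "n = k + m"
      and body: "convex_body (halfcut C a b)" "convex_body (halfcut C (- a) (- b))"
      and opt: "maxmin_width n C \<le> maxmin_width k (halfcut C a b)"
        "maxmin_width n C \<le> maxmin_width m (halfcut C (- a) (- b))"
      using maxmin_width_optimal_first_cut[OF C \<open>2 \<le> n\<close>] .
    have "\<exists>t. convex_body (halfcut C a t) \<and> convex_body (halfcut C (- a) (- t)) \<and>
        maxmin_width k (halfcut C a t) = maxmin_width m (halfcut C (- a) (- t)) \<and>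
        maxmin_width n C \<le> maxmin_width k (halfcut C a t)"
    proof (cases "maxmin_width k (halfcut C a b) \<le> maxmin_width m (halfcut C (- a) (- b))")
      case True
      from balancing_cut[OF C km(1,2) a body True] opt(1) show ?thesis by fastforce
    next
      case False
      have "\<exists>t. convex_body (halfcut C (- a) t) \<and> convex_body (halfcut C (- (- a)) (- t)) \<and>
          maxmin_width m (halfcut C (- a) t) = maxmin_width k (halfcut C (- (- a)) (- t)) \<and>
          maxmin_width m (halfcut C (- a) (- b)) \<le> maxmin_width m (halfcut C (- a) t)"
        by (rule balancing_cut[OF C km(2,1)]) (use a body False in auto)
      then obtain t where "convex_body (halfcut C (- a) t)" "convex_body (halfcut C a (- t))"
          "maxmin_width m (halfcut C (- a) t) = maxmin_width k (halfcut C a (- t))"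
          "maxmin_width m (halfcut C (- a) (- b)) \<le> maxmin_width m (halfcut C (- a) t)"
        by auto
      with opt(2) show ?thesis by (intro exI[of _ "- t"]) auto
    qed
    then obtain t where body: "convex_body (halfcut C a t)" "convex_body (halfcut C (- a) (- t))"
      and eq: "maxmin_width k (halfcut C a t) = maxmin_width m (halfcut C (- a) (- t))"
      and ge: "maxmin_width n C \<le> maxmin_width k (halfcut C a t)" by blast
    obtain P where P: "n_division (halfcut C a t) k P"
        "\<forall>S\<in>P. width S = maxmin_width k (halfcut C a t)"
      using less.IH[OF _ body(1) km(1)] km by auto
    obtain Q where Q: "n_division (halfcut C (- a) (- t)) m Q"
        "\<forall>S\<in>Q. width S = maxmin_width m (halfcut C (- a) (- t))"
      using less.IH[OF _ body(2) km(2)] km by auto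
    have "a \<noteq> 0" using a by auto
    have div: "n_division C n (P \<union> Q)"
      unfolding km(3) using n_division_join[OF _ \<open>a \<noteq> 0\<close> _ _ P(1) Q(1)] C body
      by (simp add: convex_body_def)
    have w: "\<forall>S\<in>P \<union> Q. width S = maxmin_width k (halfcut C a t)" using P(2) Q(2) eq by auto
    then have "maxmin_width k (halfcut C a t) \<le> division_width (P \<union> Q)"
      using division_width_ge_iff[OF div] by simp
    also have "\<dots> \<le> maxmin_width n C" by (rule division_width_le_maxmin[OF C div])
    finally show ?thesis using ge w div by force
  qed
qed

text \<open>With ratio \<open>r\<close> slightly below \<open>1\<close>, the hyperplane is moved from its position \<open>b\<close> to the convex
  combination of \<open>b\<close> and the maximal height \<open>h\<close> of \<open>C\<close> with weights \<open>r\<close> and \<open>1 - r\<close>.  The growing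
  half then contains the Minkowski combination of the old half and \<open>C\<close> with these weights, and \<open>C\<close>
  is strictly wider than the old half.  The shrinking half contains a homothetic copy of itself
  with ratio \<open>r\<close>.\<close>

lemma improve_unbalanced_cut:
  assumes C: "convex_body C" and a: "a \<noteq> 0"
    and body: "convex_body (halfcut C a b)" "convex_body (halfcut C (- a) (- b))"
    and less: "width (halfcut C a b) < width (halfcut C (- a) (- b))"
  shows "width (halfcut C a b) < maxmin_width 2 C"
proof -
  let ?L = "halfcut C a b" and ?R = "halfcut C (- a) (- b)"
  have "convex C" using C by (simp add: convex_body_def)
  obtain q where q: "q \<in> C" "\<And>x. x \<in> C \<Longrightarrow> a \<bullet> x \<le> a \<bullet> q"
    using convex_body_extreme_point[OF C, of a] by blast
  define h where "h = a \<bullet> q"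
  have pos: "0 < width ?L" using width_pos[OF body(1)] .
  have "width ?L / width ?R < 1" using less pos by simp
  \<comment> \<open>Even scaled by \<open>r\<close>, the wider half stays wider than the narrower one.\<close>
  then obtain r where r: "width ?L / width ?R < r" "r < 1" using dense by blast
  have "0 < r" using pos less r(1) by (smt (verit) divide_pos_pos)
  have rR: "width ?L < r * width ?R" using r(1) less pos by (simp add: pos_divide_less_eq)
  define t where "t = r * b + (1 - r) * h"
  have subR: "(\<lambda>x. (1 - r) *\<^sub>R q + r *\<^sub>R x) ` ?R \<subseteq> halfcut C (- a) (- t)"
  proof (rule homothety_halfcut_subset)
    fix x assume "- a \<bullet> x \<le> - b"
    then have "r * b \<le> r * (a \<bullet> x)" using \<open>0 < r\<close> by simp
    then show "(1 - r) * (- a \<bullet> q) + r * (- a \<bullet> x) \<le> - t"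
      by (simp add: t_def h_def algebra_simps)
  qed (use q r \<open>0 < r\<close> \<open>convex C\<close> in auto)
  have sumL: "r *\<^sub>R x + (1 - r) *\<^sub>R y \<in> halfcut C a t" if "x \<in> ?L" "y \<in> C" for x y
  proof -
    have "r *\<^sub>R x + (1 - r) *\<^sub>R y \<in> C"
      using convexD[OF \<open>convex C\<close>, of x y r "1 - r"] that r \<open>0 < r\<close> by (simp add: mem_halfcut)
    moreover have "r * (a \<bullet> x) + (1 - r) * (a \<bullet> y) \<le> r * b + (1 - r) * h"
      using that q(2) r \<open>0 < r\<close> by (intro add_mono mult_left_mono) (auto simp: mem_halfcut h_def)
    ultimately show ?thesis by (simp add: mem_halfcut t_def inner_add_right)
  qed
  have "interior (halfcut C (- a) (- t)) \<noteq> {}"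
    using interior_homothety_image_subset[OF _ \<open>0 < r\<close> subR] body by (simp add: convex_body_def)
  then have bR: "convex_body (halfcut C (- a) (- t))" using convex_body_halfcut_iff[OF C] by blast
  have subL: "(\<lambda>x. (1 - r) *\<^sub>R q + r *\<^sub>R x) ` ?L \<subseteq> halfcut C a t"
    using sumL q by (auto simp: add.commute)
  then have "interior (halfcut C a t) \<noteq> {}"
    using interior_homothety_image_subset[OF _ \<open>0 < r\<close> subL] body by (simp add: convex_body_def)
  then have bL: "convex_body (halfcut C a t)" using convex_body_halfcut_iff[OF C] by blast
  have "width ?R \<le> width C" by (rule width_mono[OF body(2) C]) (auto simp: halfcut_def)
  with less have "width ?L < width C" by simp
  then have "r * width ?L + (1 - r) * width ?L < r * width ?L + (1 - r) * width C"
    using r by simp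
  also have "\<dots> \<le> width (halfcut C a t)"
    using sumL body bL C r \<open>0 < r\<close> convex_body_nonempty
    by (intro width_convex_combination) (auto simp: convex_body_def)
  finally have L: "width ?L < width (halfcut C a t)" by (simp add: algebra_simps)
  have "r * width ?R \<le> width (halfcut C (- a) (- t))"
    using subR body bR \<open>0 < r\<close> convex_body_nonempty[OF body(2)]
    by (intro width_homothety_le) (auto simp: convex_body_def)
  with rR have R: "width ?L < width (halfcut C (- a) (- t))" by simp
  have div: "n_division C 2 ({halfcut C a t} \<union> {halfcut C (- a) (- t)})"
    using n_division_join[OF _ a _ _ n_division.start n_division.start] C bL bR
    by (simp add: convex_body_def numeral_2_eq_2)
  have "width ?L < division_width ({halfcut C a t} \<union> {halfcut C (- a) (- t)})"
    using L R by (simp add: division_width_def)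
  also have "\<dots> \<le> maxmin_width 2 C" by (rule division_width_le_maxmin[OF C div])
  finally show ?thesis .
qed

lemma optimal_2_division_balanced:
  assumes C: "convex_body C" and opt: "optimal_division C 2 P"
  shows "balanced P"
proof -
  have P: "n_division C 2 P" "division_width P = maxmin_width 2 C"
    using opt by (auto simp: optimal_division_def)
  from n_division_first_cutE[OF P(1) C order_refl]
  obtain a b k m P1 P2 where a: "norm a = 1" and km: "2 = k + m" "1 \<le> k" "1 \<le> m"
    and body: "convex_body (halfcut C a b)" "convex_body (halfcut C (- a) (- b))"
    and div: "n_division (halfcut C a b) k P1" "n_division (halfcut C (- a) (- b)) m P2"
    and Pe: "P = P1 \<union> P2" .
  have "k = 1" "m = 1" using km by auto
  then have Pe: "P = {halfcut C a b, halfcut C (- a) (- b)}"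
    using n_division_1[of "halfcut C a b" P1] n_division_1[of "halfcut C (- a) (- b)" P2] div Pe
    by (simp add: insert_commute)
  then have M: "maxmin_width 2 C = min (width (halfcut C a b)) (width (halfcut C (- a) (- b)))"
    using P(2) by (simp add: division_width_def)
  have "a \<noteq> 0" using a by auto
  have "\<not> width (halfcut C a b) < width (halfcut C (- a) (- b))"
    using improve_unbalanced_cut[OF C \<open>a \<noteq> 0\<close> body] M by auto
  moreover have "\<not> width (halfcut C (- a) (- b)) < width (halfcut C a b)"
    using improve_unbalanced_cut[of C "- a" "- b"] C \<open>a \<noteq> 0\<close> body M by auto
  ultimately show ?thesis unfolding balanced_def Pe by auto
qed

theorem theorem4p9:
  fixes C :: "'a::euclidean_space set" and n :: nat
  assumes "DIM('a) \<ge> 2" and "convex_body C" and "n \<ge> 2"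
  shows "(\<exists>P. optimal_division C n P \<and> balanced P) \<and>
         (\<forall>P. optimal_division C 2 P \<longrightarrow> balanced P)"
proof (intro conjI allI impI)
  have "1 \<le> n" using assms(3) by simp
  then obtain P where P: "n_division C n P" "\<forall>S\<in>P. width S = maxmin_width n C"
    using balanced_optimal_division[OF assms(2)] by blast
  then have "width ` P = {maxmin_width n C}" using n_division_finite[OF P(1)] by auto
  then have "division_width P = maxmin_width n C" by (simp add: division_width_def)
  with P show "\<exists>P. optimal_division C n P \<and> balanced P"
    by (auto simp: optimal_division_def balanced_def)
qed (rule optimal_2_division_balanced[OF assms(2)])

end
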